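(* Let $G=GL_n(\mathbb{F}_q)$, let $g\in G$, and let $\pi=(\pi_1,\ldots,\pi_\ell)$ be a sequence of positive integers with $\pi_1+\cdots+\pi_\ell=n$. Then $$\mathrm{Card}(Y^{-1}_{P_\pi}(g))=\frac{1}{W_\pi(q)}\sum_{w\in W_\pi}\mathrm{Card}(Y^{-1}_{BwB}(g)).$$
   Context: $\mathbb{F}_q$ is a finite field with $q$ elements, $G=GL_n(\mathbb{F}_q)$, $B$ is the subgroup of upper triangular matrices, and $W\cong S_n$ is the subgroup of permutation matrices with length function $\ell(w)$ (number of inversions). For $g\in G$, $w\in W$, the Lusztig variety is $Y^{-1}_{BwB}(g)=\{yB\in G/B\mid y^{-1}gy\in BwB\}$. $P_\pi$ is the subgroup of $G$ of block upper triangular matrices with block sizes $\pi_1,\ldots,\pi_\ell$; $W_\pi=S_{\pi_1}\times\cdots\times S_{\pi_\ell}\subseteq S_n=W$ is the corresponding Young subgroup (permuting consecutive blocks of sizes $\pi_1,\dots,\pi_\ell$), so that $P_\pi=\bigsqcup_{w\in W_\pi}BwB$; and $W_\pi(q)=\sum_{w\in W_\pi}q^{\ell(w)}$. The $\pi$-parabolic Springer fiber over $g$ is $$Y^{-1}_{P_\pi}(g)=\{yP_\pi\in G/P_\pi\mid y^{-1}gy\in P_\pi\}.$$ *)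

theory Defs
  imports
    "Jordan_Normal_Form.Matrix"
    "HOL-Algebra.Left_Coset"
    "HOL-Combinatorics.Permutations"
    "HOL-Library.Cardinality"
begin

text \<open>
  Row and column indices of an \<open>n \<times> n\<close> matrix are \<open>0, \<dots>, n - 1\<close>, and \<open>S\<^sub>n\<close> is the set of
  permutations of \<open>{..<n}\<close>.
\<close>

definition GL :: "nat \<Rightarrow> 'a::field mat monoid" where
  "GL n = units_of (ring_mat TYPE('a) n ())"

definition borel_subgroup :: "nat \<Rightarrow> 'a::field mat set" where
  "borel_subgroup n = {A \<in> carrier (GL n). upper_triangular A}"

text \<open>The matrix of \<open>e\<^sub>j \<mapsto> e\<^bsub>w j\<^esub>\<close>.\<close>

definition perm_matrix :: "nat \<Rightarrow> (nat \<Rightarrow> nat) \<Rightarrow> 'a::field mat" where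
  "perm_matrix n w = mat n n (\<lambda>(i, j). if i = w j then 1 else 0)"

definition perm_length :: "nat \<Rightarrow> (nat \<Rightarrow> nat) \<Rightarrow> nat" where
  "perm_length n w = card {(i, j). i < j \<and> j < n \<and> w j < w i}"

definition bruhat_cell :: "nat \<Rightarrow> (nat \<Rightarrow> nat) \<Rightarrow> 'a::field mat set" where
  "bruhat_cell n w =
     (borel_subgroup n #>\<^bsub>GL n\<^esub> perm_matrix n w) <#>\<^bsub>GL n\<^esub> borel_subgroup n"

text \<open>
  The \<open>k\<close>-th of the consecutive blocks of indices of sizes \<open>\<pi> ! 0, \<pi> ! 1, \<dots>\<close>
  (for \<open>k < length \<pi>\<close>).
\<close>

definition block :: "nat list \<Rightarrow> nat \<Rightarrow> nat set" where
  "block \<pi> k = {sum_list (take k \<pi>)..<sum_list (take (Suc k) \<pi>)}"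

definition parabolic_subgroup :: "nat \<Rightarrow> nat list \<Rightarrow> 'a::field mat set" where
  "parabolic_subgroup n \<pi> = {A \<in> carrier (GL n).
     \<forall>k < length \<pi>. \<forall>l < k. \<forall>i \<in> block \<pi> k. \<forall>j \<in> block \<pi> l. A $$ (i, j) = 0}"

definition young_subgroup :: "nat \<Rightarrow> nat list \<Rightarrow> (nat \<Rightarrow> nat) set" where
  "young_subgroup n \<pi> =
     {w. w permutes {..<n} \<and> (\<forall>k < length \<pi>. w ` block \<pi> k = block \<pi> k)}"

definition young_poincare :: "nat \<Rightarrow> nat list \<Rightarrow> rat \<Rightarrow> rat" where
  "young_poincare n \<pi> q = (\<Sum>w\<in>young_subgroup n \<pi>. q ^ perm_length n w)"

text \<open>
  \<open>{yB \<in> G/B | y\<^sup>-\<^sup>1 g y \<in> BwB}\<close> and \<open>{yP \<in> G/P | y\<^sup>-\<^sup>1 g y \<in> P}\<close>, as sets of left cosets.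
\<close>

definition lusztig_variety :: "nat \<Rightarrow> (nat \<Rightarrow> nat) \<Rightarrow> 'a::field mat \<Rightarrow> 'a mat set set" where
  "lusztig_variety n w g =
     {y <#\<^bsub>GL n\<^esub> borel_subgroup n | y.
        y \<in> carrier (GL n) \<and> inv\<^bsub>GL n\<^esub> y \<otimes>\<^bsub>GL n\<^esub> g \<otimes>\<^bsub>GL n\<^esub> y \<in> bruhat_cell n w}"

definition parabolic_springer_fiber :: "nat \<Rightarrow> nat list \<Rightarrow> 'a::field mat \<Rightarrow> 'a mat set set" where
  "parabolic_springer_fiber n \<pi> g =
     {y <#\<^bsub>GL n\<^esub> parabolic_subgroup n \<pi> | y.
        y \<in> carrier (GL n) \<and> inv\<^bsub>GL n\<^esub> y \<otimes>\<^bsub>GL n\<^esub> g \<otimes>\<^bsub>GL n\<^esub> y \<in> parabolic_subgroup n \<pi>}"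

end

theory Submission
  imports Defs "Jordan_Normal_Form.Determinant"
begin

text \<open>
  Write \<open>B\<close> for the Borel subgroup, \<open>P\<close> for the parabolic subgroup of \<open>\<pi>\<close> and \<open>q\<close> for the order of
  the field. Consider the elements \<open>y\<close> of \<open>G\<close> with \<open>y\<^sup>-\<^sup>1 g y \<in> P\<close>. They form a union of left
  cosets of \<open>P\<close>, so there are \<open>|P|\<close> times as many of them as points in the Springer fiber. On the
  other hand \<open>P\<close> is the disjoint union of the cells \<open>BwB\<close> with \<open>w\<close> in the Young subgroup, and the
  \<open>y\<close> with \<open>y\<^sup>-\<^sup>1 g y \<in> BwB\<close> form a union of left cosets of \<open>B\<close>, one for each point of the
  Lusztig variety of \<open>w\<close> (\<open>card_conjugators_into\<close> covers both counts). Dividing by \<open>|B|\<close>, the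
  index \<open>|P| / |B|\<close> times the size of the fiber is the sum of the sizes of the Lusztig varieties.

  It remains to see that this index is the Poincare polynomial of the Young subgroup at \<open>q\<close>. By
  the same decomposition it suffices that \<open>|BwB| = |B| q\<^bsup>l(w)\<^esup>\<close> (\<open>card_bruhat_cell\<close>). The number
  of elements of a double coset \<open>BwB\<close> is \<open>|B|\<^sup>2 / |B \<inter> w\<^sup>-\<^sup>1Bw|\<close>, and the intersection consists of
  the invertible upper triangular matrices that vanish at the inversions of \<open>w\<close>, whose number is
  obtained by counting free entries.

  The decomposition of \<open>P\<close> comes from that of \<open>G\<close>: elimination with upper triangular row and
  column operations reduces every invertible matrix to a permutation matrix
  (\<open>bruhat_decomposition\<close>), the permutation is unique (\<open>bruhat_cell_inj\<close>), and a cell \<open>BwB\<close> lies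
  in \<open>P\<close> or is disjoint from it according to whether \<open>w\<close> preserves the blocks
  (\<open>bruhat_cell_parabolic\<close>).
\<close>

section \<open>Counting in finite groups\<close>

text \<open>Left multiplication by \<open>x\<close> is injective on the finite set \<open>H\<close>, so it hits \<open>\<one>\<close>.\<close>

lemma (in group) finite_submonoid_imp_subgroup:
  assumes "H \<subseteq> carrier G" "finite H" "\<one> \<in> H"
    and closed: "\<And>x y. x \<in> H \<Longrightarrow> y \<in> H \<Longrightarrow> x \<otimes> y \<in> H"
  shows "subgroup H G"
proof (rule subgroupI)
  fix x assume x: "x \<in> H"
  have "inj_on (\<lambda>y. x \<otimes> y) H"
    using x assms(1) by (intro inj_onI) (metis Units_eq Units_l_cancel subsetD)
  then have "(\<lambda>y. x \<otimes> y) ` H = H"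
    using x closed \<open>finite H\<close> by (intro endo_inj_surj) auto
  then obtain y where y: "y \<in> H" "x \<otimes> y = \<one>"
    using \<open>\<one> \<in> H\<close> by (metis imageE)
  then have "inv x = y"
    using x assms(1) by (metis inv_equality inv_inv subsetD)
  then show "inv x \<in> H" using y by simp
qed (use assms in auto)

lemma (in group) card_eq_card_times_lcosets:
  assumes H: "subgroup H G" and "finite (carrier G)" "Y \<subseteq> carrier G"
    and stable: "\<And>y h. y \<in> Y \<Longrightarrow> h \<in> H \<Longrightarrow> y \<otimes> h \<in> Y"
  shows "card Y = card H * card {y <#\<^bsub>G\<^esub> H | y. y \<in> Y}"
proof -
  let ?C = "{y <#\<^bsub>G\<^esub> H | y. y \<in> Y}"
  have HG: "H \<subseteq> carrier G" using H by (rule subgroup.subset)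
  have sub: "?C \<subseteq> lcosets H" using \<open>Y \<subseteq> carrier G\<close> by (auto simp: LCOSETS_def)
  have un: "\<Union> ?C = Y"
  proof
    show "\<Union> ?C \<subseteq> Y" using stable by (auto simp: l_coset_def)
    show "Y \<subseteq> \<Union> ?C" using lcos_self[OF _ H] \<open>Y \<subseteq> carrier G\<close> by blast
  qed
  have "finite Y" using assms by (auto intro: finite_subset)
  have "card H * card ?C = card (\<Union> ?C)"
  proof (rule card_partition)
    show "finite ?C" using \<open>finite Y\<close> by simp
    show "finite (\<Union> ?C)" using un \<open>finite Y\<close> by simp
    show "card c = card H" if "c \<in> ?C" for c
      using l_card_cosets_equal[OF _ HG \<open>finite (carrier G)\<close>] that sub by auto
    show "c \<inter> d = {}" if "c \<in> ?C" "d \<in> ?C" "c \<noteq> d" for c d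
    proof -
      have "c \<in> lcosets H" "d \<in> lcosets H" using that sub by blast+
      then show ?thesis using lcos_disjoint[OF H] \<open>c \<noteq> d\<close> by (simp add: pairwise_def disjnt_def)
    qed
  qed
  then show ?thesis using un by simp
qed

text \<open>
  Orbit counting for the map \<open>H \<times> H \<rightarrow> HxH\<close>, \<open>(a, b) \<mapsto> axb\<close>: the fibre through \<open>(a, b)\<close>
  consists of the pairs \<open>(a (x k x\<^sup>-\<^sup>1)\<^sup>-\<^sup>1, k b)\<close> with \<open>k \<in> H \<inter> x\<^sup>-\<^sup>1Hx\<close>.
\<close>

lemma (in group) card_double_coset:
  assumes H: "subgroup H G" and "finite H" and x: "x \<in> carrier G"
  shows "card ((H #> x) <#> H) * card {h \<in> H. x \<otimes> h \<otimes> inv x \<in> H} = card H * card H"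
proof -
  let ?K = "{h \<in> H. x \<otimes> h \<otimes> inv x \<in> H}"
  define f where "f = (\<lambda>(a, b). a \<otimes> x \<otimes> b)"
  have HG [simp]: "h \<in> carrier G" if "h \<in> H" for h using H that by (rule subgroup.mem_carrier)
  note cl = subgroup.m_closed[OF H] subgroup.m_inv_closed[OF H]
  have im: "(H #> x) <#> H = f ` (H \<times> H)"
    by (force simp: f_def set_mult_def r_coset_def)
  have fibre: "card {p \<in> H \<times> H. f p = y} = card ?K" if "y \<in> f ` (H \<times> H)" for y
  proof -
    from that obtain a b where ab: "a \<in> H" "b \<in> H" and y: "y = a \<otimes> x \<otimes> b"
      by (auto simp: f_def)
    have to_K: "x \<otimes> (d \<otimes> inv b) \<otimes> inv x = inv c \<otimes> a"
      if "c \<in> H" "d \<in> H" "c \<otimes> x \<otimes> d = y" for c d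
    proof -
      have "x \<otimes> (d \<otimes> inv b) \<otimes> inv x = inv c \<otimes> (c \<otimes> x \<otimes> d) \<otimes> inv b \<otimes> inv x"
        using that(1,2) ab x by (simp add: m_assoc[symmetric])
      also have "\<dots> = inv c \<otimes> a"
        unfolding that(3) y using that(1,2) ab x by (simp add: m_assoc)
      finally show ?thesis .
    qed
    have from_K: "a \<otimes> inv (x \<otimes> k \<otimes> inv x) \<otimes> x \<otimes> (k \<otimes> b) = y" if "k \<in> H" for k
    proof -
      define h where "h = x \<otimes> k \<otimes> inv x"
      have h: "h \<in> carrier G" "x \<otimes> k = h \<otimes> x"
        using that x by (simp_all add: h_def m_assoc)
      have "a \<otimes> inv h \<otimes> x \<otimes> (k \<otimes> b) = a \<otimes> inv h \<otimes> (x \<otimes> k) \<otimes> b"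
        using that ab x h(1) by (simp add: m_assoc)
      also have "\<dots> = a \<otimes> (inv h \<otimes> h) \<otimes> x \<otimes> b"
        using ab x h(1) unfolding h(2) by (simp only: m_assoc m_closed inv_closed HG)
      also have "\<dots> = y" using ab x h(1) by (simp add: y)
      finally show ?thesis by (simp add: h_def)
    qed
    have "bij_betw (\<lambda>k. (a \<otimes> inv (x \<otimes> k \<otimes> inv x), k \<otimes> b)) ?K {p \<in> H \<times> H. f p = y}"
    proof (rule bij_betw_byWitness[where f' = "\<lambda>p. snd p \<otimes> inv b"])
      show "\<forall>k\<in>?K. snd (a \<otimes> inv (x \<otimes> k \<otimes> inv x), k \<otimes> b) \<otimes> inv b = k"
        using ab by (simp add: m_assoc)
      show "(\<lambda>k. (a \<otimes> inv (x \<otimes> k \<otimes> inv x), k \<otimes> b)) ` ?K \<subseteq> {p \<in> H \<times> H. f p = y}"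
      proof (rule image_subsetI)
        fix k assume k: "k \<in> ?K"
        then have "inv (x \<otimes> k \<otimes> inv x) \<in> H" using cl(2) by blast
        then have "a \<otimes> inv (x \<otimes> k \<otimes> inv x) \<in> H" "k \<otimes> b \<in> H" using k ab cl(1) by blast+
        then show "(a \<otimes> inv (x \<otimes> k \<otimes> inv x), k \<otimes> b) \<in> {p \<in> H \<times> H. f p = y}"
          using k from_K by (simp only: f_def mem_Collect_eq mem_Times_iff fst_conv snd_conv prod.case)
      qed
      have "(a \<otimes> inv (x \<otimes> (d \<otimes> inv b) \<otimes> inv x), d \<otimes> inv b \<otimes> b) = (c, d)"
        if "c \<in> H" "d \<in> H" "c \<otimes> x \<otimes> d = y" for c d
        unfolding to_K[OF that] using that(1,2) ab
        by (simp add: inv_mult_group m_assoc[symmetric]) (simp add: m_assoc)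
      then show "\<forall>p\<in>{p \<in> H \<times> H. f p = y}.
          (a \<otimes> inv (x \<otimes> (snd p \<otimes> inv b) \<otimes> inv x), snd p \<otimes> inv b \<otimes> b) = p"
        by (auto simp: f_def)
      show "(\<lambda>p. snd p \<otimes> inv b) ` {p \<in> H \<times> H. f p = y} \<subseteq> ?K"
        using ab cl by (auto simp: f_def to_K)
    qed
    then show ?thesis by (rule bij_betw_same_card[symmetric])
  qed
  have "card H * card H = (\<Sum>p\<in>H \<times> H. 1)" by (simp add: card_cartesian_product)
  also have "\<dots> = (\<Sum>y\<in>f ` (H \<times> H). \<Sum>p\<in>{p \<in> H \<times> H. f p = y}. 1)"
    using \<open>finite H\<close> by (intro sum.image_gen) auto
  also have "\<dots> = (\<Sum>y\<in>f ` (H \<times> H). card ?K)"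
    using fibre by (intro sum.cong) auto
  finally show ?thesis by (simp add: im)
qed

section \<open>The general linear group\<close>

lemma mult_GL [simp]: "x \<otimes>\<^bsub>GL n\<^esub> y = x * y"
  by (simp add: GL_def units_of_mult ring_mat_simps)

lemma one_GL [simp]: "\<one>\<^bsub>GL n\<^esub> = 1\<^sub>m n"
  by (simp add: GL_def units_of_one ring_mat_simps)

lemma group_GL: "group (GL n)"
  unfolding GL_def using ring_mat[of n] by (intro monoid.units_group ring.is_monoid)

lemma carrier_GL: "carrier (GL n :: 'a::field mat monoid) = {A \<in> carrier_mat n n. det A \<noteq> 0}"
proof -
  have "A \<in> carrier_mat n n" if "A \<in> Units (ring_mat TYPE('a) n ())" for A
    using that by (simp add: Units_def ring_mat_simps)
  moreover have "det A \<noteq> 0" if "A \<in> Units (ring_mat TYPE('a) n ())" for A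
    using that by (rule unit_imp_det_non_zero)
  ultimately show ?thesis
    using det_non_zero_imp_unit[where b = "()"] by (auto simp: GL_def units_of_carrier)
qed

lemma GL_carrier_matD [dest]: "A \<in> carrier (GL n) \<Longrightarrow> A \<in> carrier_mat n n"
  by (simp add: carrier_GL)

lemma upper_triangular_in_GL_iff:
  assumes "A \<in> carrier_mat n n" "\<And>i j. j < i \<Longrightarrow> i < n \<Longrightarrow> A $$ (i, j) = 0"
  shows "A \<in> carrier (GL n) \<longleftrightarrow> (\<forall>i<n. A $$ (i, i) \<noteq> (0::'a::field))"
proof -
  have "det A = (\<Prod>i = 0..<n. A $$ (i, i))"
    using assms det_upper_triangular[of A n]
    by (auto simp: prod_list_diag_prod intro!: upper_triangularI)
  then show ?thesis using assms(1) by (auto simp: carrier_GL)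
qed

lemma finite_carrier_mat: "finite (carrier_mat n m :: 'a::finite mat set)"
proof -
  have "carrier_mat n m \<subseteq> (\<lambda>f. mat n m f) ` (({..<n} \<times> {..<m}) \<rightarrow>\<^sub>E (UNIV :: 'a set))"
  proof
    fix A :: "'a mat" assume "A \<in> carrier_mat n m"
    then have "A = mat n m (restrict (\<lambda>p. A $$ p) ({..<n} \<times> {..<m}))"
      by (intro eq_matI) auto
    then show "A \<in> (\<lambda>f. mat n m f) ` (({..<n} \<times> {..<m}) \<rightarrow>\<^sub>E UNIV)"
      by (intro image_eqI[where x = "restrict (\<lambda>p. A $$ p) ({..<n} \<times> {..<m})"]) auto
  qed
  moreover have "finite (({..<n} \<times> {..<m}) \<rightarrow>\<^sub>E (UNIV :: 'a set))"
    by (intro finite_PiE) auto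
  ultimately show ?thesis by (auto intro: finite_subset)
qed

lemma finite_GL: "finite (carrier (GL n :: 'a::{field, finite} mat monoid))"
  by (rule finite_subset[OF _ finite_carrier_mat[of n n]]) auto

lemma index_mult_sum:
  assumes "A \<in> carrier_mat n n" "B \<in> carrier_mat n n" "i < n" "j < n"
  shows "(A * B) $$ (i, j) = (\<Sum>k<n. A $$ (i, k) * B $$ (k, j))"
  using assms by (auto simp: scalar_prod_def atLeast0LessThan intro!: sum.cong)

lemma GL_mult_closed: "A \<in> carrier (GL n) \<Longrightarrow> B \<in> carrier (GL n) \<Longrightarrow> A * B \<in> carrier (GL n)"
  using monoid.m_closed[OF group.is_monoid[OF group_GL], of A n B] by simp

lemma GL_mult_assoc:
  "A \<in> carrier (GL n) \<Longrightarrow> B \<in> carrier (GL n) \<Longrightarrow> C \<in> carrier (GL n) \<Longrightarrow> A * B * C = A * (B * C)"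
  by (rule assoc_mult_mat[OF GL_carrier_matD GL_carrier_matD GL_carrier_matD])

section \<open>Matrix groups cut out by a preorder\<close>

text \<open>
  The invertible elements of the incidence algebra of a preorder \<open>R\<close>. The Borel subgroup, its
  intersection with a conjugate by a permutation matrix, and the parabolic subgroups all have
  this form, so closure and cardinality need to be established only here.
\<close>

definition incidence_group :: "nat \<Rightarrow> (nat \<Rightarrow> nat \<Rightarrow> bool) \<Rightarrow> 'a::field mat set" where
  "incidence_group n R = {A \<in> carrier (GL n). \<forall>i<n. \<forall>j<n. A $$ (i, j) \<noteq> 0 \<longrightarrow> R i j}"

lemma subgroup_incidence_group:
  assumes "reflp R" "transp R"
  shows "subgroup (incidence_group n R :: 'a::{field, finite} mat set) (GL n)"
proof -
  interpret group "GL n :: 'a mat monoid" by (rule group_GL)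
  show ?thesis
  proof (rule finite_submonoid_imp_subgroup)
    show "incidence_group n R \<subseteq> carrier (GL n)" by (auto simp: incidence_group_def)
    then show "finite (incidence_group n R :: 'a mat set)" by (rule finite_subset) (rule finite_GL)
    show "\<one>\<^bsub>GL n :: 'a mat monoid\<^esub> \<in> incidence_group n R"
      using one_closed reflpD[OF \<open>reflp R\<close>] by (auto simp: incidence_group_def)
    fix A B :: "'a mat" assume A: "A \<in> incidence_group n R" and B: "B \<in> incidence_group n R"
    then have car: "A \<in> carrier (GL n)" "B \<in> carrier (GL n)" by (auto simp: incidence_group_def)
    have "R i j" if "i < n" "j < n" "(A * B) $$ (i, j) \<noteq> 0" for i j
    proof -
      have "(\<Sum>k<n. A $$ (i, k) * B $$ (k, j)) \<noteq> 0"
        using that car by (subst (asm) index_mult_sum) auto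
      then obtain k where "k < n" "A $$ (i, k) * B $$ (k, j) \<noteq> 0"
        by (meson lessThan_iff sum.neutral)
      then have "R i k" "R k j" using A B that by (auto simp: incidence_group_def)
      then show ?thesis using \<open>transp R\<close> by (blast dest: transpD)
    qed
    then show "A \<otimes>\<^bsub>GL n\<^esub> B \<in> incidence_group n R"
      using m_closed[OF car] by (auto simp: incidence_group_def)
  qed
qed

text \<open>
  A triangular matrix is invertible when its diagonal has no zero; the remaining entries allowed
  by \<open>R\<close> are free.
\<close>

lemma card_incidence_group_triangular:
  assumes "reflp R" and le: "\<And>i j. R i j \<Longrightarrow> i \<le> j"
  shows "card (incidence_group n R :: 'a::{field, finite} mat set) =
    (CARD('a) - 1) ^ n * CARD('a) ^ card {(i, j). i < j \<and> j < n \<and> R i j}"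
proof -
  define I where "I = {..<n} \<times> {..<n}"
  define T :: "nat \<times> nat \<Rightarrow> 'a set" where
    "T = (\<lambda>(i, j). if i = j then UNIV - {0} else if R i j then UNIV else {0})"
  have [simp]: "finite I" by (simp add: I_def)
  have "bij_betw (\<lambda>f. mat n n f) (PiE I T) (incidence_group n R)"
  proof (rule bij_betw_byWitness[where f' = "\<lambda>A. restrict (\<lambda>p. A $$ p) I"])
    show "\<forall>f\<in>PiE I T. restrict (\<lambda>p. mat n n f $$ p) I = f"
      by (auto simp: I_def PiE_def extensional_def restrict_def fun_eq_iff)
    show "\<forall>A\<in>incidence_group n R. mat n n (restrict (\<lambda>p. A $$ p) I) = (A :: 'a mat)"
      by (auto simp: I_def incidence_group_def carrier_GL intro!: eq_matI)
    show "(\<lambda>f. mat n n f) ` PiE I T \<subseteq> incidence_group n R"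
    proof (rule image_subsetI)
      fix f assume f: "f \<in> PiE I T"
      have val: "f (i, j) \<in> T (i, j)" if "i < n" "j < n" for i j
        using f that by (auto simp: I_def)
      have "mat n n f \<in> carrier (GL n)"
      proof (subst upper_triangular_in_GL_iff)
        show "mat n n f $$ (i, j) = 0" if "j < i" "i < n" for i j
          using val[of i j] that le[of i j] by (auto simp: T_def split: if_splits)
        show "\<forall>i<n. mat n n f $$ (i, i) \<noteq> 0" using val by (fastforce simp: T_def)
      qed simp
      moreover have "R i j" if "i < n" "j < n" "mat n n f $$ (i, j) \<noteq> 0" for i j
        using val[of i j] that reflpD[OF \<open>reflp R\<close>] by (auto simp: T_def split: if_splits)
      ultimately show "mat n n f \<in> incidence_group n R" by (auto simp: incidence_group_def)
    qed
    show "(\<lambda>A. restrict (\<lambda>p. A $$ p) I) ` incidence_group n R \<subseteq> PiE I T"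
    proof (rule image_subsetI)
      fix A :: "'a mat" assume A: "A \<in> incidence_group n R"
      then have supp: "\<And>i j. i < n \<Longrightarrow> j < n \<Longrightarrow> A $$ (i, j) \<noteq> 0 \<Longrightarrow> R i j"
        by (auto simp: incidence_group_def)
      have "A \<in> carrier (GL n)" using A by (auto simp: incidence_group_def)
      moreover have "A $$ (i, j) = 0" if "j < i" "i < n" for i j
        using supp[of i j] le[of i j] that by auto
      ultimately have "\<forall>i<n. A $$ (i, i) \<noteq> 0"
        using upper_triangular_in_GL_iff[of A n] by auto
      moreover have "\<And>i j. i < n \<Longrightarrow> j < n \<Longrightarrow> \<not> R i j \<Longrightarrow> A $$ (i, j) = 0"
        using supp by blast
      ultimately show "restrict (\<lambda>p. A $$ p) I \<in> PiE I T" by (auto simp: I_def T_def)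
    qed
  qed
  then have "card (incidence_group n R :: 'a mat set) = card (PiE I T)"
    by (simp add: bij_betw_same_card)
  also have "\<dots> = (\<Prod>p\<in>I. card (T p))" by (simp add: card_PiE)
  also have "\<dots> = (\<Prod>p\<in>I. (if fst p = snd p then CARD('a) - 1 else 1) *
      (if fst p < snd p \<and> R (fst p) (snd p) then CARD('a) else 1))"
    using le by (intro prod.cong) (fastforce simp: T_def card_Diff_singleton)+
  also have "\<dots> = (CARD('a) - 1) ^ card {p \<in> I. fst p = snd p} *
      CARD('a) ^ card {p \<in> I. fst p < snd p \<and> R (fst p) (snd p)}"
    by (simp add: prod.distrib prod.inter_filter[symmetric])
  also have "{p \<in> I. fst p = snd p} = (\<lambda>i. (i, i)) ` {..<n}" by (auto simp: I_def)
  also have "card \<dots> = n" by (simp add: card_image inj_on_def)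
  also have "{p \<in> I. fst p < snd p \<and> R (fst p) (snd p)} = {(i, j). i < j \<and> j < n \<and> R i j}"
    by (auto simp: I_def)
  finally show ?thesis .
qed

section \<open>Permutation matrices and the size of a Bruhat cell\<close>

lemma borel_subgroup_eq_incidence_group: "borel_subgroup n = incidence_group n (\<le>)"
proof -
  have "(\<forall>i<n. \<forall>j<i. A $$ (i, j) = 0) \<longleftrightarrow> (\<forall>i<n. \<forall>j<n. A $$ (i, j) \<noteq> 0 \<longrightarrow> i \<le> j)"
    for A :: "'a mat" by (meson le_less_linear less_le_not_le less_trans)
  then show ?thesis
    by (simp add: borel_subgroup_def incidence_group_def upper_triangular_def carrier_GL
        cong: conj_cong)
qed

lemma subgroup_borel: "subgroup (borel_subgroup n :: 'a::{field, finite} mat set) (GL n)"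
  unfolding borel_subgroup_eq_incidence_group
  by (rule subgroup_incidence_group) (auto intro: reflpI transpI)

lemma perm_matrix_carrier [simp]: "perm_matrix n w \<in> carrier_mat n n"
  by (simp add: perm_matrix_def)

lemma perm_matrix_mult:
  assumes "w permutes {..<n}" "A \<in> carrier_mat n n" "i < n" "j < n"
  shows "(perm_matrix n w * A) $$ (w i, j) = A $$ (i, j)"
proof -
  have "w i < n" using permutes_in_image[OF assms(1)] assms(3) by blast
  then have "(perm_matrix n w * A) $$ (w i, j) = (\<Sum>k<n. if i = k then A $$ (i, j) else 0)"
    using assms inj_eq[OF permutes_inj[OF assms(1)]]
    by (subst index_mult_sum) (auto simp: perm_matrix_def if_distrib[of "\<lambda>x. x * _"] cong: if_cong)
  then show ?thesis using \<open>i < n\<close> by simp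
qed

lemma mult_perm_matrix:
  assumes "w permutes {..<n}" "A \<in> carrier_mat n n" "i < n" "j < n"
  shows "(A * perm_matrix n w) $$ (i, j) = A $$ (i, w j)"
proof -
  have "w j < n" using permutes_in_image[OF assms(1)] assms(4) by blast
  have "(A * perm_matrix n w) $$ (i, j) = (\<Sum>k<n. if k = w j then A $$ (i, w j) else 0)"
    using assms
    by (subst index_mult_sum) (auto simp: perm_matrix_def if_distrib[of "\<lambda>x. _ * x"] cong: if_cong)
  then show ?thesis using \<open>w j < n\<close> by simp
qed

lemma perm_matrix_in_GL:
  assumes "w permutes {..<n}"
  shows "perm_matrix n w \<in> carrier (GL n)"
proof -
  let ?v = "inv_into UNIV w"
  have "perm_matrix n w * perm_matrix n ?v = (1\<^sub>m n :: 'a mat)"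
  proof (rule eq_matI)
    fix i j assume "i < dim_row (1\<^sub>m n :: 'a mat)" "j < dim_col (1\<^sub>m n :: 'a mat)"
    then show "(perm_matrix n w * perm_matrix n ?v) $$ (i, j) = (1\<^sub>m n :: 'a mat) $$ (i, j)"
      using mult_perm_matrix[OF permutes_inv[OF assms], of "perm_matrix n w :: 'a mat" i j]
        permutes_inverses(1)[OF assms] permutes_in_image[OF permutes_inv[OF assms], of j]
      by (auto simp: perm_matrix_def)
  qed (auto simp: perm_matrix_def)
  then have "det (perm_matrix n w :: 'a mat) * det (perm_matrix n ?v) = 1"
    by (metis det_mult det_one perm_matrix_carrier)
  then show ?thesis by (auto simp: carrier_GL)
qed

text \<open>
  Conjugation by the matrix of \<open>w\<close> moves the entry at \<open>(i, j)\<close> to \<open>(w i, w j)\<close>, so the conjugate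
  is upper triangular when the support of \<open>b\<close> respects the order of the values of \<open>w\<close>.
\<close>

lemma borel_conjugate_perm_matrix:
  fixes w :: "nat \<Rightarrow> nat"
  assumes w: "w permutes {..<n}"
  shows "{b \<in> borel_subgroup n. perm_matrix n w \<otimes>\<^bsub>GL n\<^esub> b \<otimes>\<^bsub>GL n\<^esub> inv\<^bsub>GL n\<^esub> perm_matrix n w
      \<in> borel_subgroup n} = (incidence_group n (\<lambda>i j. i \<le> j \<and> w i \<le> w j) :: 'a::field mat set)"
proof -
  interpret group "GL n :: 'a mat monoid" by (rule group_GL)
  let ?P = "perm_matrix n w :: 'a mat"
  have P: "?P \<in> carrier (GL n)" using w by (rule perm_matrix_in_GL)
  have ran: "w i < n \<longleftrightarrow> i < n" for i using permutes_in_image[OF w, of i] by simp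
  have conj: "?P * b * inv\<^bsub>GL n\<^esub> ?P \<in> incidence_group n (\<le>) \<longleftrightarrow>
      b \<in> incidence_group n (\<lambda>i j. w i \<le> w j)" if b: "b \<in> carrier (GL n)" for b
  proof -
    define c where "c = ?P * b * inv\<^bsub>GL n\<^esub> ?P"
    have c: "c \<in> carrier (GL n)"
      using m_closed[OF m_closed[OF P b] inv_closed[OF P]] by (simp add: c_def)
    have "c * ?P = ?P * b"
      using m_assoc[OF m_closed[OF P b] inv_closed[OF P] P] l_inv[OF P]
        r_one[OF m_closed[OF P b]]
      by (simp add: c_def)
    then have entry: "c $$ (w i, w j) = b $$ (i, j)" if "i < n" "j < n" for i j
      using mult_perm_matrix[OF w, of c "w i" j] perm_matrix_mult[OF w, of b i j]
        GL_carrier_matD[OF b] GL_carrier_matD[OF c] that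
      by (simp add: ran)
    have "(\<forall>i<n. \<forall>j<n. c $$ (i, j) \<noteq> 0 \<longrightarrow> i \<le> j) \<longleftrightarrow>
        (\<forall>i<n. \<forall>j<n. c $$ (w i, w j) \<noteq> 0 \<longrightarrow> w i \<le> w j)"
      by (metis ran permutes_inverses(1)[OF w])
    then show ?thesis using b c entry by (simp add: incidence_group_def c_def)
  qed
  have "incidence_group n (\<lambda>i j. i \<le> j \<and> w i \<le> w j) =
      incidence_group n (\<le>) \<inter> (incidence_group n (\<lambda>i j. w i \<le> w j) :: 'a mat set)"
    by (auto simp: incidence_group_def)
  moreover have "b \<in> carrier (GL n)" if "b \<in> incidence_group n (\<le>)" for b :: "'a mat"
    using that by (simp add: incidence_group_def)
  ultimately show ?thesis
    using conj unfolding borel_subgroup_eq_incidence_group by auto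
qed

text \<open>
  The double coset formula gives \<open>|BwB| = |B|\<^sup>2 / |K|\<close> with \<open>K = B \<inter> w\<^sup>-\<^sup>1Bw\<close>, and the index of
  \<open>K\<close> in \<open>B\<close> is \<open>q\<close> to the number of positions \<open>i < j\<close> that are free in \<open>B\<close> but not in \<open>K\<close>:
  these are the inversions of \<open>w\<close>.
\<close>

lemma card_bruhat_cell:
  fixes w :: "nat \<Rightarrow> nat"
  assumes w: "w permutes {..<n}"
  shows "card (bruhat_cell n w :: 'a::{field, finite} mat set) =
    card (borel_subgroup n :: 'a mat set) * CARD('a) ^ perm_length n w"
proof -
  interpret group "GL n :: 'a mat monoid" by (rule group_GL)
  let ?B = "borel_subgroup n :: 'a mat set"
  let ?K = "incidence_group n (\<lambda>i j. i \<le> j \<and> w i \<le> w j) :: 'a mat set"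
  let ?pairs = "{(i, j). i < j \<and> j < n \<and> i \<le> j}"
  let ?noninv = "{(i, j). i < j \<and> j < n \<and> i \<le> j \<and> w i \<le> w j}"
  let ?inv = "{(i, j). i < j \<and> j < n \<and> w j < w i}"
  have fin: "finite ?B"
    by (rule finite_subset[OF _ finite_GL[of n]]) (auto simp: borel_subgroup_def)
  have "card ?pairs = card ?noninv + card ?inv"
  proof (subst card_Un_disjoint[symmetric])
    have "finite ({..<n} \<times> {..<n})" by simp
    then show "finite ?noninv" "finite ?inv" by (rule rev_finite_subset, auto)+
  qed (auto intro!: arg_cong[where f = card])
  then have "card ?B = card ?K * CARD('a) ^ perm_length n w"
    unfolding borel_subgroup_eq_incidence_group
    by (subst (1 2) card_incidence_group_triangular)
       (auto intro: reflpI simp: perm_length_def power_add)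
  moreover have "card (bruhat_cell n w :: 'a mat set) * card ?K = card ?B * card ?B"
    using card_double_coset[OF subgroup_borel fin perm_matrix_in_GL[OF w]]
    by (simp only: bruhat_cell_def borel_conjugate_perm_matrix[OF w])
  moreover have "card ?B > 0"
    using fin subgroup.one_closed[OF subgroup_borel] by (auto simp: card_gt_0_iff)
  ultimately show ?thesis
    by (simp add: mult_ac)
qed

section \<open>The Bruhat decomposition\<close>

text \<open>
  Products with an identity matrix one of whose columns (rows) has been replaced; these are the
  elementary operations of the elimination below.
\<close>

lemma replace_column_mult:
  fixes A :: "'a::field mat"
  assumes "A \<in> carrier_mat n n" "i < n" "r < n" "c < n"
  shows "(mat n n (\<lambda>(r, m). if m = i then v r else if r = m then 1 else 0) * A) $$ (r, c) =
    (if r = i then 0 else A $$ (r, c)) + v r * A $$ (i, c)"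
proof -
  have "(mat n n (\<lambda>(r, m). if m = i then v r else if r = m then 1 else 0) * A) $$ (r, c) =
      (\<Sum>m<n. (if m = i then v r * A $$ (i, c) else 0)
        + (if m = r then if r = i then 0 else A $$ (r, c) else 0))"
    unfolding index_mult_sum[OF mat_carrier assms(1,3,4)]
    by (rule sum.cong[OF refl]) (use assms in auto)
  then show ?thesis using assms by (simp add: sum.distrib add.commute)
qed

lemma mult_replace_row:
  fixes A :: "'a::field mat"
  assumes "A \<in> carrier_mat n n" "k < n" "r < n" "c < n"
  shows "(A * mat n n (\<lambda>(m, c). if m = k then u c else if m = c then 1 else 0)) $$ (r, c) =
    (if c = k then 0 else A $$ (r, c)) + A $$ (r, k) * u c"
proof -
  have "(A * mat n n (\<lambda>(m, c). if m = k then u c else if m = c then 1 else 0)) $$ (r, c) =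
      (\<Sum>m<n. (if m = k then A $$ (r, k) * u c else 0)
        + (if m = c then if c = k then 0 else A $$ (r, c) else 0))"
    unfolding index_mult_sum[OF assms(1) mat_carrier assms(3,4)]
    by (rule sum.cong[OF refl]) (use assms in auto)
  then show ?thesis using assms by (simp add: sum.distrib add.commute)
qed

lemma GL_column_nonzero:
  fixes A :: "'a::field mat"
  assumes A: "A \<in> carrier (GL n)" and k: "k < n"
  obtains i where "i < n" "A $$ (i, k) \<noteq> 0"
proof -
  interpret group "GL n :: 'a mat monoid" by (rule group_GL)
  let ?A' = "inv\<^bsub>GL n\<^esub> A"
  have "?A' * A = 1\<^sub>m n" using l_inv[OF A] by simp
  then have "(\<Sum>i<n. ?A' $$ (k, i) * A $$ (i, k)) = 1"
    using index_mult_sum[OF GL_carrier_matD[OF inv_closed[OF A]] GL_carrier_matD[OF A] k k] k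
    by simp
  then have "(\<Sum>i<n. ?A' $$ (k, i) * A $$ (i, k)) \<noteq> 0" by simp
  then obtain i where "i < n" "?A' $$ (k, i) * A $$ (i, k) \<noteq> 0"
    by (meson lessThan_iff sum.neutral)
  then show ?thesis using that by auto
qed

lemma upper_triangular_in_borel:
  assumes "\<And>i j. j < i \<Longrightarrow> i < n \<Longrightarrow> f (i, j) = 0" "\<And>i. i < n \<Longrightarrow> f (i, i) \<noteq> (0::'a::field)"
  shows "mat n n f \<in> borel_subgroup n"
proof -
  have "mat n n f \<in> carrier (GL n)"
    using assms by (subst upper_triangular_in_GL_iff) auto
  then show ?thesis using assms by (auto simp: borel_subgroup_def)
qed

lemma borel_in_GL: "b \<in> borel_subgroup n \<Longrightarrow> b \<in> carrier (GL n)"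
  by (simp add: borel_subgroup_def)

lemma borel_diagonal_nonzero:
  assumes b: "b \<in> borel_subgroup n" and "i < n"
  shows "b $$ (i, i) \<noteq> 0"
proof -
  have car: "b \<in> carrier_mat n n" using borel_in_GL[OF b] by (rule GL_carrier_matD)
  moreover have "b $$ (i, j) = 0" if "j < i" "i < n" for i j
    using b car that by (auto simp: borel_subgroup_def)
  ultimately have "\<forall>i<n. b $$ (i, i) \<noteq> 0"
    using borel_in_GL[OF b] upper_triangular_in_GL_iff[of b n] by blast
  then show ?thesis using \<open>i < n\<close> by blast
qed

text \<open>
  Gaussian elimination restricted to operations from \<open>B\<close>: scaling, adding a multiple of a row to a
  row above it, and of a column to a column on its right. The pivot of a column must therefore be
  its lowest nonzero entry; it clears the entries above it, and then the rest of its own row. The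
  columns treated earlier survive, because their pivot rows already vanish outside the pivot.
\<close>

lemma bruhat_elimination:
  fixes A :: "'a::{field, finite} mat"
  assumes A: "A \<in> carrier (GL n)" and "k \<le> n"
  shows "\<exists>b\<in>borel_subgroup n. \<exists>c\<in>borel_subgroup n. \<exists>w. \<forall>j<k. w j < n \<and>
    (\<forall>i<n. (b * A * c) $$ (i, j) = (if i = w j then 1 else 0)) \<and>
    (\<forall>l<n. (b * A * c) $$ (w j, l) = (if l = j then 1 else 0))"
  using \<open>k \<le> n\<close>
proof (induction k)
  case 0
  then show ?case using subgroup.one_closed[OF subgroup_borel] by auto
next
  case (Suc k)
  interpret group "GL n :: 'a mat monoid" by (rule group_GL)
  from Suc.IH[OF Suc_leD[OF Suc.prems]] obtain b c w
    where b: "b \<in> borel_subgroup n" and c: "c \<in> borel_subgroup n"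
    and *: "\<forall>j<k. w j < n \<and>
      (\<forall>i<n. (b * A * c) $$ (i, j) = (if i = w j then 1 else 0)) \<and>
      (\<forall>l<n. (b * A * c) $$ (w j, l) = (if l = j then 1 else 0))"
    by blast
  have w: "\<And>j. j < k \<Longrightarrow> w j < n"
    and col: "\<And>i j. j < k \<Longrightarrow> i < n \<Longrightarrow> (b * A * c) $$ (i, j) = (if i = w j then 1 else 0)"
    and row: "\<And>j l. j < k \<Longrightarrow> l < n \<Longrightarrow> (b * A * c) $$ (w j, l) = (if l = j then 1 else 0)"
    using * by blast+
  define M where "M = b * A * c"
  have M: "M \<in> carrier (GL n)"
    using m_closed[OF m_closed[OF borel_in_GL[OF b] A] borel_in_GL[OF c]] by (simp add: M_def)
  have Mc: "M \<in> carrier_mat n n" using M by auto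
  have k: "k < n" using Suc.prems by simp
  \<comment> \<open>the row of the lowest nonzero entry in column \<open>k\<close>\<close>
  define i where "i = Max {i. i < n \<and> M $$ (i, k) \<noteq> 0}"
  have "{i. i < n \<and> M $$ (i, k) \<noteq> 0} \<noteq> {}" using GL_column_nonzero[OF M k] by blast
  then have "i \<in> {i. i < n \<and> M $$ (i, k) \<noteq> 0}" unfolding i_def by (intro Max_in) auto
  then have i: "i < n" "M $$ (i, k) \<noteq> 0" by auto
  have below: "M $$ (r, k) = 0" if "i < r" "r < n" for r
  proof (rule ccontr)
    assume "M $$ (r, k) \<noteq> 0"
    then have "r \<le> i" unfolding i_def using that by (intro Max_ge) auto
    then show False using that by simp
  qed
  have w_ne: "w j \<noteq> i" if "j < k" for j using row[OF that k] i that by (auto simp: M_def)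
  \<comment> \<open>left multiplication by \<open>e\<close> turns column \<open>k\<close> into the unit vector \<open>e\<^sub>i\<close>\<close>
  define v where "v r = (if r = i then 1 else - M $$ (r, k)) / M $$ (i, k)" for r
  define e where "e = mat n n (\<lambda>(r, m). if m = i then v r else if r = m then 1 else 0)"
  have e: "e \<in> borel_subgroup n"
    unfolding e_def using i below by (intro upper_triangular_in_borel) (auto simp: v_def)
  define N where "N = e * M"
  have Nc: "N \<in> carrier_mat n n" using e Mc by (auto simp: N_def e_def)
  have N: "N $$ (r, l) = (if r = i then 0 else M $$ (r, l)) + v r * M $$ (i, l)"
    if "r < n" "l < n" for r l
    unfolding N_def e_def using Mc i that by (intro replace_column_mult) auto
  have N_col: "N $$ (r, j) = (if r = w j then 1 else 0)" if "j < k" "r < n" for r j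
    using N[of r j] col[OF that] col[OF that(1) i(1)] w_ne[OF that(1)] that k
    by (auto simp: M_def)
  have N_colk: "N $$ (r, k) = (if r = i then 1 else 0)" if "r < n" for r
    using N[OF that k] i by (simp add: v_def)
  have N_row: "N $$ (w j, l) = (if l = j then 1 else 0)" if "j < k" "l < n" for j l
    using N[OF w that(2), of j] row[OF that] row[OF that(1) k] w_ne[OF that(1)] that
    by (simp add: M_def v_def)
  \<comment> \<open>right multiplication by \<open>f\<close> then clears row \<open>i\<close>\<close>
  define u where "u l = (if l = k then 1 else - N $$ (i, l))" for l
  define f where "f = mat n n (\<lambda>(m, l). if m = k then u l else if m = l then 1 else 0)"
  have f: "f \<in> borel_subgroup n"
    unfolding f_def
    using N_col[OF _ i(1)] w_ne k by (intro upper_triangular_in_borel) (auto simp: u_def)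
  define L where "L = N * f"
  have L: "L $$ (r, l) = (if l = k then 0 else N $$ (r, l)) + N $$ (r, k) * u l"
    if "r < n" "l < n" for r l
    unfolding L_def f_def using Nc k that by (intro mult_replace_row) auto
  have L_col: "L $$ (r, j) = (if r = (w(k := i)) j then 1 else 0)" if "j < Suc k" "r < n" for r j
  proof (cases "j = k")
    case True
    then show ?thesis using L[OF that(2) k] N_colk[OF that(2)] by (simp add: u_def)
  next
    case False
    then have "j < k" using that by simp
    then show ?thesis using L[of r j] N_col[of j] w_ne[of j] k i(1) that by (auto simp: u_def)
  qed
  have L_row: "L $$ ((w(k := i)) j, l) = (if l = j then 1 else 0)" if "j < Suc k" "l < n" for j l
  proof (cases "j = k")
    case True
    then show ?thesis using L[OF i(1) that(2)] N_colk[OF i(1)] by (simp add: u_def)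
  next
    case False
    then have "j < k" using that by simp
    then show ?thesis using L[OF w, of j l] N_row[of j] N_colk[OF w, of j] w_ne[of j] k that by auto
  qed
  have car: "e \<in> carrier (GL n)" "b \<in> carrier (GL n)" "c \<in> carrier (GL n)" "f \<in> carrier (GL n)"
    using e b c f by (auto intro: borel_in_GL)
  have "(e * b) * A * (c * f) = L"
    using car A by (simp add: L_def N_def M_def GL_mult_assoc GL_mult_closed)
  moreover have "e * b \<in> borel_subgroup n" "c * f \<in> borel_subgroup n"
    using subgroup.m_closed[OF subgroup_borel e b] subgroup.m_closed[OF subgroup_borel c f] by auto
  moreover have "(w(k := i)) j < n" if "j < Suc k" for j
    using that w[of j] i(1) by auto
  ultimately show ?case using L_col L_row
    by (intro bexI[of _ "e * b"] bexI[of _ "c * f"] exI[of _ "w(k := i)"]) auto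
qed

lemma bruhat_cell_iff:
  "A \<in> bruhat_cell n w \<longleftrightarrow>
    (\<exists>b\<in>borel_subgroup n. \<exists>c\<in>borel_subgroup n. A = b * perm_matrix n w * c)"
  by (auto simp: bruhat_cell_def set_mult_def r_coset_def)

lemma bruhat_cell_subset_GL:
  "w permutes {..<n} \<Longrightarrow> bruhat_cell n w \<subseteq> carrier (GL n :: 'a::field mat monoid)"
proof
  fix A :: "'a mat" assume w: "w permutes {..<n}" and "A \<in> bruhat_cell n w"
  then obtain b c where "b \<in> carrier (GL n)" "c \<in> carrier (GL n)" "A = b * perm_matrix n w * c"
    by (auto simp: bruhat_cell_iff dest: borel_in_GL)
  then show "A \<in> carrier (GL n)"
    using perm_matrix_in_GL[OF w, where 'a = 'a] by (simp add: GL_mult_closed)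
qed

lemma bruhat_decomposition:
  fixes A :: "'a::{field, finite} mat"
  assumes A: "A \<in> carrier (GL n)"
  obtains w where "w permutes {..<n}" "A \<in> bruhat_cell n w"
proof -
  interpret group "GL n :: 'a mat monoid" by (rule group_GL)
  from bruhat_elimination[OF A order_refl] obtain b c w
    where b: "b \<in> borel_subgroup n" and c: "c \<in> borel_subgroup n"
    and *: "\<forall>j<n. w j < n \<and>
      (\<forall>i<n. (b * A * c) $$ (i, j) = (if i = w j then 1 else 0)) \<and>
      (\<forall>l<n. (b * A * c) $$ (w j, l) = (if l = j then 1 else 0))"
    by blast
  have w: "\<And>j. j < n \<Longrightarrow> w j < n"
    and col: "\<And>i j. j < n \<Longrightarrow> i < n \<Longrightarrow> (b * A * c) $$ (i, j) = (if i = w j then 1 else 0)"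
    and row: "\<And>j l. j < n \<Longrightarrow> l < n \<Longrightarrow> (b * A * c) $$ (w j, l) = (if l = j then 1 else 0)"
    using * by blast+
  have bG: "b \<in> carrier (GL n)" and cG: "c \<in> carrier (GL n)" using b c by (auto intro: borel_in_GL)
  have "inj_on w {..<n}"
  proof (rule inj_onI)
    fix j l assume "j \<in> {..<n}" "l \<in> {..<n}" "w j = w l"
    then show "j = l" using row[of j j] row[of l j] by (simp split: if_splits)
  qed
  moreover have "w ` {..<n} \<subseteq> {..<n}" using w by auto
  ultimately have "bij_betw w {..<n} {..<n}"
    by (simp add: bij_betw_def endo_inj_surj)
  define w' where "w' j = (if j < n then w j else j)" for j
  have w': "w' permutes {..<n}"
  proof (rule bij_imp_permutes)
    show "bij_betw w' {..<n} {..<n}"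
      using \<open>bij_betw w _ _\<close> by (rule bij_betw_cong[THEN iffD1, rotated]) (simp add: w'_def)
  qed (simp add: w'_def)
  have "b * A * c \<in> carrier_mat n n"
    using m_closed[OF m_closed[OF bG A] cG] by auto
  then have "b * A * c = perm_matrix n w'"
    using col by (intro eq_matI) (auto simp: perm_matrix_def w'_def)
  then have "A = inv\<^bsub>GL n\<^esub> b * perm_matrix n w' * inv\<^bsub>GL n\<^esub> c"
    using m_assoc[simplified] l_inv[OF bG] r_inv[OF cG] bG cG A
    by (metis (no_types, lifting) inv_closed l_one m_closed mult_GL one_GL r_one)
  then have "A \<in> bruhat_cell n w'"
    using subgroup.m_inv_closed[OF subgroup_borel] b c by (auto simp: bruhat_cell_iff)
  with w' show ?thesis by (rule that)
qed

text \<open>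
  If \<open>b w c = b' v c'\<close>, then \<open>d w = v e\<close> with \<open>d, e \<in> B\<close>. Comparing entries, the nonzero diagonal of
  \<open>d\<close> reappears in \<open>e\<close> at the positions \<open>(v\<^sup>-\<^sup>1 w j, j)\<close>, so \<open>v\<^sup>-\<^sup>1 w j \<le> j\<close> for every \<open>j\<close>; a
  permutation with this property is the identity.
\<close>

lemma bruhat_cell_inj:
  fixes A :: "'a::{field, finite} mat"
  assumes w: "w permutes {..<n}" and v: "v permutes {..<n}"
    and "A \<in> bruhat_cell n w" "A \<in> bruhat_cell n v"
  shows "w = v"
proof -
  interpret group "GL n :: 'a mat monoid" by (rule group_GL)
  let ?W = "perm_matrix n w :: 'a mat" and ?V = "perm_matrix n v :: 'a mat"
  obtain b c b' c' where bor: "b \<in> borel_subgroup n" "c \<in> borel_subgroup n"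
      "b' \<in> borel_subgroup n" "c' \<in> borel_subgroup n"
    and A: "A = b * ?W * c" "A = b' * ?V * c'"
    using assms(3,4) by (auto simp: bruhat_cell_iff)
  have W: "?W \<in> carrier (GL n)" and V: "?V \<in> carrier (GL n)"
    using w v by (auto intro: perm_matrix_in_GL)
  note G = bor[THEN borel_in_GL]
  define d where "d = inv\<^bsub>GL n\<^esub> b' * b"
  define e where "e = c' * inv\<^bsub>GL n\<^esub> c"
  have d: "d \<in> borel_subgroup n" and e: "e \<in> borel_subgroup n"
  proof -
    note B = subgroup_borel[of n, where 'a = 'a]
    show "d \<in> borel_subgroup n"
      using subgroup.m_closed[OF B subgroup.m_inv_closed[OF B bor(3)] bor(1)] by (simp add: d_def)
    show "e \<in> borel_subgroup n"
      using subgroup.m_closed[OF B bor(4) subgroup.m_inv_closed[OF B bor(2)]] by (simp add: e_def)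
  qed
  have "d * ?W = inv\<^bsub>GL n\<^esub> b' \<otimes>\<^bsub>GL n\<^esub> b \<otimes>\<^bsub>GL n\<^esub> ?W \<otimes>\<^bsub>GL n\<^esub> (c \<otimes>\<^bsub>GL n\<^esub> inv\<^bsub>GL n\<^esub> c)"
    using G W by (simp only: r_inv r_one m_closed inv_closed) (simp add: d_def)
  also have "\<dots> = inv\<^bsub>GL n\<^esub> b' \<otimes>\<^bsub>GL n\<^esub> (b \<otimes>\<^bsub>GL n\<^esub> ?W \<otimes>\<^bsub>GL n\<^esub> c) \<otimes>\<^bsub>GL n\<^esub> inv\<^bsub>GL n\<^esub> c"
    using G W by (simp only: m_assoc m_closed inv_closed)
  also have "b \<otimes>\<^bsub>GL n\<^esub> ?W \<otimes>\<^bsub>GL n\<^esub> c = b' \<otimes>\<^bsub>GL n\<^esub> ?V \<otimes>\<^bsub>GL n\<^esub> c'"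
    using A by simp
  also have "inv\<^bsub>GL n\<^esub> b' \<otimes>\<^bsub>GL n\<^esub> (b' \<otimes>\<^bsub>GL n\<^esub> ?V \<otimes>\<^bsub>GL n\<^esub> c') \<otimes>\<^bsub>GL n\<^esub> inv\<^bsub>GL n\<^esub> c =
      (inv\<^bsub>GL n\<^esub> b' \<otimes>\<^bsub>GL n\<^esub> b') \<otimes>\<^bsub>GL n\<^esub> (?V \<otimes>\<^bsub>GL n\<^esub> (c' \<otimes>\<^bsub>GL n\<^esub> inv\<^bsub>GL n\<^esub> c))"
    using G V by (simp only: m_assoc m_closed inv_closed)
  also have "\<dots> = ?V * e"
    using G V by (simp only: l_inv l_one m_closed inv_closed) (simp add: e_def)
  finally have eq: "d * ?W = ?V * e" .
  have "inv_into UNIV v (w j) \<le> j" if "j < n" for j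
  proof -
    let ?i = "inv_into UNIV v (w j)"
    have wj: "w j < n" using permutes_in_image[OF w, of j] that by simp
    have i: "?i < n" using permutes_in_image[OF permutes_inv[OF v], of "w j"] wj by simp
    have "d $$ (w j, w j) = (d * ?W) $$ (w j, j)"
      using mult_perm_matrix[OF w GL_carrier_matD[OF borel_in_GL[OF d]] wj that] by simp
    also have "\<dots> = (?V * e) $$ (v ?i, j)"
      using permutes_inverses(1)[OF v] by (simp add: eq)
    also have "\<dots> = e $$ (?i, j)"
      by (rule perm_matrix_mult[OF v GL_carrier_matD[OF borel_in_GL[OF e]] i that])
    finally have "d $$ (w j, w j) = e $$ (?i, j)" .
    moreover have "d $$ (w j, w j) \<noteq> 0"
      using d wj by (rule borel_diagonal_nonzero)
    ultimately show ?thesis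
      using e i that by (auto simp: borel_subgroup_eq_incidence_group incidence_group_def)
  qed
  then have "inv_into UNIV v \<circ> w = id"
    using permutes_compose[OF w permutes_inv[OF v]] by (intro permutes_natset_le) auto
  then show "w = v"
    using permutes_inv_o(1)[OF v] by (metis comp_assoc comp_id id_comp)
qed

section \<open>Parabolic subgroups\<close>

text \<open>
  The index \<open>i\<close> lies in the block of \<open>j\<close> or in an earlier one, phrased through the initial
  segments that are unions of blocks. In this form reflexivity and transitivity are immediate,
  and so is the comparison with permutations preserving these segments.
\<close>

definition block_preorder :: "nat list \<Rightarrow> nat \<Rightarrow> nat \<Rightarrow> bool" where
  "block_preorder \<pi> i j \<longleftrightarrow>
    (\<forall>k. j < sum_list (take k \<pi>) \<longrightarrow> i < sum_list (take k \<pi>))"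

lemma sum_list_take_mono: "k \<le> l \<Longrightarrow> sum_list (take k \<pi>) \<le> sum_list (take l (\<pi> :: nat list))"
  by (metis append_take_drop_id le_add1 min.absorb1 sum_list_append take_take)

lemma sum_list_take_le: "sum_list (take k \<pi>) \<le> sum_list (\<pi> :: nat list)"
  by (metis append_take_drop_id le_add1 sum_list_append)

lemma obtain_block:
  assumes "i < sum_list \<pi>"
  obtains k where "k < length \<pi>" "i \<in> block \<pi> k"
proof -
  define m where "m = (LEAST m. i < sum_list (take m \<pi>))"
  have ex: "i < sum_list (take (length \<pi>) \<pi>)" using assms by simp
  have m: "i < sum_list (take m \<pi>)" unfolding m_def using ex by (rule LeastI)
  have "m \<le> length \<pi>" unfolding m_def using ex by (rule Least_le)
  moreover have "m \<noteq> 0" using m by (metis less_nat_zero_code sum_list.Nil take0)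
  then obtain k where "m = Suc k" by (cases m) auto
  moreover have "\<not> i < sum_list (take k \<pi>)"
    using not_less_Least[of k "\<lambda>m. i < sum_list (take m \<pi>)"] \<open>m = Suc k\<close> by (simp add: m_def)
  ultimately show ?thesis using m that[of k] by (simp add: block_def)
qed

lemma not_block_preorder_iff:
  assumes "i < sum_list \<pi>" "j < sum_list \<pi>"
  shows "\<not> block_preorder \<pi> i j \<longleftrightarrow>
    (\<exists>k<length \<pi>. \<exists>l<k. i \<in> block \<pi> k \<and> j \<in> block \<pi> l)"
proof
  assume "\<not> block_preorder \<pi> i j"
  then obtain m where m: "j < sum_list (take m \<pi>)" "sum_list (take m \<pi>) \<le> i"
    by (auto simp: block_preorder_def)
  obtain k where k: "k < length \<pi>" "i \<in> block \<pi> k" using assms(1) by (rule obtain_block)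
  obtain l where l: "l < length \<pi>" "j \<in> block \<pi> l" using assms(2) by (rule obtain_block)
  have "sum_list (take l \<pi>) < sum_list (take m \<pi>)" using m(1) l(2) by (simp add: block_def)
  then have "l < m" using sum_list_take_mono[of m l \<pi>] by linarith
  moreover have "sum_list (take m \<pi>) < sum_list (take (Suc k) \<pi>)"
    using m(2) k(2) by (simp add: block_def)
  then have "m < Suc k" using sum_list_take_mono[of "Suc k" m \<pi>] by linarith
  ultimately have "l < k" by simp
  then show "\<exists>k<length \<pi>. \<exists>l<k. i \<in> block \<pi> k \<and> j \<in> block \<pi> l" using k l by blast
next
  assume "\<exists>k<length \<pi>. \<exists>l<k. i \<in> block \<pi> k \<and> j \<in> block \<pi> l"
  then obtain k l where "l < k" "i \<in> block \<pi> k" "j \<in> block \<pi> l" by blast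
  moreover from \<open>l < k\<close> have "sum_list (take (Suc l) \<pi>) \<le> sum_list (take k \<pi>)"
    by (intro sum_list_take_mono) simp
  ultimately have "j < sum_list (take k \<pi>)" "\<not> i < sum_list (take k \<pi>)"
    by (auto simp: block_def)
  then show "\<not> block_preorder \<pi> i j" by (auto simp: block_preorder_def)
qed

lemma block_lt: "k < length \<pi> \<Longrightarrow> i \<in> block \<pi> k \<Longrightarrow> i < sum_list \<pi>"
  using sum_list_take_le[of "Suc k" \<pi>] by (auto simp: block_def)

lemma parabolic_subgroup_eq_incidence_group:
  "parabolic_subgroup (sum_list \<pi>) \<pi> = incidence_group (sum_list \<pi>) (block_preorder \<pi>)"
proof -
  have "(\<forall>k<length \<pi>. \<forall>l<k. \<forall>i\<in>block \<pi> k. \<forall>j\<in>block \<pi> l. A $$ (i, j) = 0) \<longleftrightarrow>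
      (\<forall>i<sum_list \<pi>. \<forall>j<sum_list \<pi>. A $$ (i, j) \<noteq> 0 \<longrightarrow> block_preorder \<pi> i j)"
    for A :: "'a mat"
    by (meson block_lt less_trans not_block_preorder_iff)
  then show ?thesis by (simp add: parabolic_subgroup_def incidence_group_def)
qed

lemma subgroup_parabolic:
  "subgroup (parabolic_subgroup (sum_list \<pi>) \<pi> :: 'a::{field, finite} mat set) (GL (sum_list \<pi>))"
  unfolding parabolic_subgroup_eq_incidence_group
  by (rule subgroup_incidence_group) (auto intro!: reflpI transpI simp: block_preorder_def)

lemma borel_subset_parabolic:
  "borel_subgroup (sum_list \<pi>) \<subseteq> parabolic_subgroup (sum_list \<pi>) \<pi>"
  unfolding borel_subgroup_eq_incidence_group parabolic_subgroup_eq_incidence_group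
  by (auto simp: incidence_group_def block_preorder_def intro: le_less_trans)

text \<open>
  A permutation that maps each initial union of blocks into itself maps it onto itself, by
  finiteness, and hence preserves the differences of consecutive unions, which are the blocks.
\<close>

lemma young_subgroup_iff_block_preorder:
  assumes w: "w permutes {..<sum_list \<pi>}"
  shows "w \<in> young_subgroup (sum_list \<pi>) \<pi> \<longleftrightarrow> (\<forall>j<sum_list \<pi>. block_preorder \<pi> (w j) j)"
proof
  assume "w \<in> young_subgroup (sum_list \<pi>) \<pi>"
  then have blk: "\<And>l. l < length \<pi> \<Longrightarrow> w ` block \<pi> l = block \<pi> l"
    by (simp add: young_subgroup_def)
  show "\<forall>j<sum_list \<pi>. block_preorder \<pi> (w j) j"
    unfolding block_preorder_def
  proof (intro allI impI)
    fix j k assume "j < sum_list \<pi>" and jk: "j < sum_list (take k \<pi>)"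
    then obtain l where l: "l < length \<pi>" "j \<in> block \<pi> l" using obtain_block by blast
    then have "w j \<in> block \<pi> l" using blk by blast
    have "sum_list (take l \<pi>) < sum_list (take k \<pi>)" using l jk by (simp add: block_def)
    then have "Suc l \<le> k" using sum_list_take_mono[of k l \<pi>] by linarith
    then show "w j < sum_list (take k \<pi>)"
      using sum_list_take_mono[of "Suc l" k \<pi>] \<open>w j \<in> block \<pi> l\<close> by (simp add: block_def)
  qed
next
  assume pre: "\<forall>j<sum_list \<pi>. block_preorder \<pi> (w j) j"
  have init: "w ` {..<sum_list (take k \<pi>)} = {..<sum_list (take k \<pi>)}" for k
  proof (rule endo_inj_surj)
    show "w ` {..<sum_list (take k \<pi>)} \<subseteq> {..<sum_list (take k \<pi>)}"
    proof (rule image_subsetI)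
      fix j assume "j \<in> {..<sum_list (take k \<pi>)}"
      moreover from this have "j < sum_list \<pi>" using sum_list_take_le[of k \<pi>] by simp
      ultimately show "w j \<in> {..<sum_list (take k \<pi>)}"
        using pre by (auto simp: block_preorder_def)
    qed
  qed (use permutes_inj_on[OF w] in auto)
  have "block \<pi> k = {..<sum_list (take (Suc k) \<pi>)} - {..<sum_list (take k \<pi>)}" for k
    by (auto simp: block_def)
  then have "w ` block \<pi> k = block \<pi> k" for k
    by (simp only: image_set_diff[OF permutes_inj[OF w]] init)
  then show "w \<in> young_subgroup (sum_list \<pi>) \<pi>" using w by (simp add: young_subgroup_def)
qed

lemma perm_matrix_in_parabolic_iff:
  assumes w: "w permutes {..<sum_list \<pi>}"
  shows "(perm_matrix (sum_list \<pi>) w :: 'a::field mat) \<in> parabolic_subgroup (sum_list \<pi>) \<pi> \<longleftrightarrow>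
    w \<in> young_subgroup (sum_list \<pi>) \<pi>"
proof -
  have "w j < sum_list \<pi>" if "j < sum_list \<pi>" for j
    using permutes_in_image[OF w, of j] that by simp
  then show ?thesis
    using perm_matrix_in_GL[OF w, where 'a = 'a]
    unfolding young_subgroup_iff_block_preorder[OF w] parabolic_subgroup_eq_incidence_group
    by (auto simp: incidence_group_def perm_matrix_def)
qed

text \<open>Since \<open>B \<subseteq> P\<close>, membership of \<open>b w c\<close> in \<open>P\<close> depends on \<open>w\<close> alone.\<close>

lemma bruhat_cell_parabolic:
  fixes A :: "'a::{field, finite} mat"
  assumes w: "w permutes {..<sum_list \<pi>}" and A: "A \<in> bruhat_cell (sum_list \<pi>) w"
  shows "A \<in> parabolic_subgroup (sum_list \<pi>) \<pi> \<longleftrightarrow> w \<in> young_subgroup (sum_list \<pi>) \<pi>"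
proof -
  let ?n = "sum_list \<pi>" and ?P = "parabolic_subgroup (sum_list \<pi>) \<pi> :: 'a mat set"
  interpret group "GL ?n :: 'a mat monoid" by (rule group_GL)
  note P = subgroup_parabolic[of \<pi>, where 'a = 'a]
  let ?W = "perm_matrix ?n w :: 'a mat"
  have W: "?W \<in> carrier (GL ?n)" using w by (rule perm_matrix_in_GL)
  obtain b c where bc: "b \<in> borel_subgroup ?n" "c \<in> borel_subgroup ?n"
    and A_eq: "A = b \<otimes>\<^bsub>GL ?n\<^esub> ?W \<otimes>\<^bsub>GL ?n\<^esub> c"
    using A by (auto simp: bruhat_cell_iff)
  note bcP = bc[THEN subsetD[OF borel_subset_parabolic]]
  note bcG = bc[THEN borel_in_GL]
  have "?W = inv\<^bsub>GL ?n\<^esub> b \<otimes>\<^bsub>GL ?n\<^esub> A \<otimes>\<^bsub>GL ?n\<^esub> inv\<^bsub>GL ?n\<^esub> c"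
  proof -
    have "inv\<^bsub>GL ?n\<^esub> b \<otimes>\<^bsub>GL ?n\<^esub> A \<otimes>\<^bsub>GL ?n\<^esub> inv\<^bsub>GL ?n\<^esub> c =
        (inv\<^bsub>GL ?n\<^esub> b \<otimes>\<^bsub>GL ?n\<^esub> b) \<otimes>\<^bsub>GL ?n\<^esub> ?W \<otimes>\<^bsub>GL ?n\<^esub> (c \<otimes>\<^bsub>GL ?n\<^esub> inv\<^bsub>GL ?n\<^esub> c)"
      unfolding A_eq using bcG W by (simp only: m_assoc m_closed inv_closed)
    then show ?thesis using bcG W by (simp only: l_inv r_inv l_one r_one)
  qed
  then have "A \<in> ?P \<longleftrightarrow> ?W \<in> ?P"
    using bcP A_eq subgroup.m_closed[OF P] subgroup.m_inv_closed[OF P] by metis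
  then show ?thesis by (simp add: perm_matrix_in_parabolic_iff[OF w])
qed

lemma finite_young_subgroup: "finite (young_subgroup n \<pi>)"
  by (rule finite_subset[OF _ finite_permutations[of "{..<n}"]]) (auto simp: young_subgroup_def)

lemma parabolic_subgroup_eq_Union_bruhat_cells:
  "(parabolic_subgroup (sum_list \<pi>) \<pi> :: 'a::{field, finite} mat set) =
    (\<Union>w\<in>young_subgroup (sum_list \<pi>) \<pi>. bruhat_cell (sum_list \<pi>) w)"
proof (intro equalityI subsetI)
  fix A :: "'a mat" assume A: "A \<in> parabolic_subgroup (sum_list \<pi>) \<pi>"
  then have "A \<in> carrier (GL (sum_list \<pi>))" by (simp add: parabolic_subgroup_def)
  then obtain w where "w permutes {..<sum_list \<pi>}" "A \<in> bruhat_cell (sum_list \<pi>) w"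
    by (rule bruhat_decomposition)
  then show "A \<in> (\<Union>w\<in>young_subgroup (sum_list \<pi>) \<pi>. bruhat_cell (sum_list \<pi>) w)"
    using A bruhat_cell_parabolic by blast
next
  fix A :: "'a mat"
  assume "A \<in> (\<Union>w\<in>young_subgroup (sum_list \<pi>) \<pi>. bruhat_cell (sum_list \<pi>) w)"
  then obtain w where "w \<in> young_subgroup (sum_list \<pi>) \<pi>" "A \<in> bruhat_cell (sum_list \<pi>) w"
    by blast
  then show "A \<in> parabolic_subgroup (sum_list \<pi>) \<pi>"
    using bruhat_cell_parabolic[of w \<pi> A] by (simp add: young_subgroup_def)
qed

lemma finite_bruhat_cell:
  "w permutes {..<n} \<Longrightarrow> finite (bruhat_cell n w :: 'a::{field, finite} mat set)"
  by (rule finite_subset[OF bruhat_cell_subset_GL finite_GL])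

lemma card_parabolic_subgroup:
  "card (parabolic_subgroup (sum_list \<pi>) \<pi> :: 'a::{field, finite} mat set) =
    card (borel_subgroup (sum_list \<pi>) :: 'a mat set) *
    (\<Sum>w\<in>young_subgroup (sum_list \<pi>) \<pi>. CARD('a) ^ perm_length (sum_list \<pi>) w)"
proof -
  have "card (parabolic_subgroup (sum_list \<pi>) \<pi> :: 'a mat set) =
      (\<Sum>w\<in>young_subgroup (sum_list \<pi>) \<pi>. card (bruhat_cell (sum_list \<pi>) w :: 'a mat set))"
    unfolding parabolic_subgroup_eq_Union_bruhat_cells
    using bruhat_cell_inj[where 'a = 'a and n = "sum_list \<pi>"]
    by (intro card_UN_disjoint finite_young_subgroup ballI finite_bruhat_cell impI)
       (auto simp: young_subgroup_def)
  then show ?thesis by (simp add: card_bruhat_cell young_subgroup_def sum_distrib_left)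
qed

section \<open>Counting conjugators\<close>

text \<open>
  The preimage in \<open>G\<close> of the varieties in question: being a plain subset of \<open>G\<close>, it can be
  decomposed along \<open>P = \<Union>BwB\<close>, which the coset spaces \<open>G/P\<close> and \<open>G/B\<close> do not allow directly.
\<close>

definition conjugators_into :: "nat \<Rightarrow> 'a::field mat \<Rightarrow> 'a mat set \<Rightarrow> 'a mat set" where
  "conjugators_into n g X =
    {y \<in> carrier (GL n). inv\<^bsub>GL n\<^esub> y \<otimes>\<^bsub>GL n\<^esub> g \<otimes>\<^bsub>GL n\<^esub> y \<in> X}"

text \<open>Replacing \<open>y\<close> by \<open>yh\<close> conjugates \<open>y\<^sup>-\<^sup>1 g y\<close> by \<open>h\<close>, so stability of \<open>X\<close> under \<open>H\<close> is enough.\<close>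

lemma card_conjugators_into:
  fixes g :: "'a::{field, finite} mat"
  assumes g: "g \<in> carrier (GL n)" and H: "subgroup H (GL n)"
    and stable: "\<And>x h. x \<in> X \<Longrightarrow> h \<in> H \<Longrightarrow> inv\<^bsub>GL n\<^esub> h \<otimes>\<^bsub>GL n\<^esub> x \<otimes>\<^bsub>GL n\<^esub> h \<in> X"
  shows "card (conjugators_into n g X) = card H * card {y <#\<^bsub>GL n\<^esub> H | y.
    y \<in> carrier (GL n) \<and> inv\<^bsub>GL n\<^esub> y \<otimes>\<^bsub>GL n\<^esub> g \<otimes>\<^bsub>GL n\<^esub> y \<in> X}"
proof -
  interpret group "GL n :: 'a mat monoid" by (rule group_GL)
  have "card (conjugators_into n g X) =
      card H * card {y <#\<^bsub>GL n\<^esub> H | y. y \<in> conjugators_into n g X}"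
  proof (rule card_eq_card_times_lcosets[OF H finite_GL])
    show "conjugators_into n g X \<subseteq> carrier (GL n)" by (auto simp: conjugators_into_def)
    fix y h assume y: "y \<in> conjugators_into n g X" and h: "h \<in> H"
    then have yG: "y \<in> carrier (GL n)" and hG: "h \<in> carrier (GL n)"
      using subgroup.mem_carrier[OF H] by (auto simp: conjugators_into_def)
    have "inv\<^bsub>GL n\<^esub> (y \<otimes>\<^bsub>GL n\<^esub> h) \<otimes>\<^bsub>GL n\<^esub> g \<otimes>\<^bsub>GL n\<^esub> (y \<otimes>\<^bsub>GL n\<^esub> h) =
        inv\<^bsub>GL n\<^esub> h \<otimes>\<^bsub>GL n\<^esub> (inv\<^bsub>GL n\<^esub> y \<otimes>\<^bsub>GL n\<^esub> g \<otimes>\<^bsub>GL n\<^esub> y) \<otimes>\<^bsub>GL n\<^esub> h"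
      using yG hG g by (simp only: inv_mult_group m_assoc m_closed inv_closed)
    then show "y \<otimes>\<^bsub>GL n\<^esub> h \<in> conjugators_into n g X"
      using y h stable m_closed[OF yG hG] by (simp only: conjugators_into_def mem_Collect_eq)
  qed
  then show ?thesis by (simp only: conjugators_into_def mem_Collect_eq)
qed

lemma card_conjugators_into_parabolic:
  fixes g :: "'a::{field, finite} mat"
  assumes "g \<in> carrier (GL (sum_list \<pi>))"
  shows "card (conjugators_into (sum_list \<pi>) g (parabolic_subgroup (sum_list \<pi>) \<pi>)) =
    card (parabolic_subgroup (sum_list \<pi>) \<pi> :: 'a mat set) *
    card (parabolic_springer_fiber (sum_list \<pi>) \<pi> g)"
  unfolding parabolic_springer_fiber_def
  by (rule card_conjugators_into[OF assms subgroup_parabolic])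
     (blast intro: subgroup.m_closed[OF subgroup_parabolic] subgroup.m_inv_closed[OF subgroup_parabolic])

lemma bruhat_cell_conjugate:
  fixes x :: "'a::{field, finite} mat"
  assumes w: "w permutes {..<n}" and x: "x \<in> bruhat_cell n w" and h: "h \<in> borel_subgroup n"
  shows "inv\<^bsub>GL n\<^esub> h \<otimes>\<^bsub>GL n\<^esub> x \<otimes>\<^bsub>GL n\<^esub> h \<in> bruhat_cell n w"
proof -
  interpret group "GL n :: 'a mat monoid" by (rule group_GL)
  note B = subgroup_borel[of n, where 'a = 'a]
  let ?W = "perm_matrix n w :: 'a mat"
  obtain b c where bc: "b \<in> borel_subgroup n" "c \<in> borel_subgroup n" and x_eq: "x = b * ?W * c"
    using x by (auto simp: bruhat_cell_iff)
  define h' where "h' = inv\<^bsub>GL n\<^esub> h"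
  have h': "h' \<in> borel_subgroup n" unfolding h'_def using h by (rule subgroup.m_inv_closed[OF B])
  have "h' * x * h = (h' * b) * ?W * (c * h)"
    using bc[THEN borel_in_GL] borel_in_GL[OF h] borel_in_GL[OF h']
      perm_matrix_in_GL[OF w, where 'a = 'a]
    by (simp add: x_eq GL_mult_assoc GL_mult_closed)
  moreover have "h' * b \<in> borel_subgroup n" "c * h \<in> borel_subgroup n"
    using subgroup.m_closed[OF B h' bc(1)] subgroup.m_closed[OF B bc(2) h] by simp_all
  ultimately show ?thesis by (auto simp: bruhat_cell_iff h'_def)
qed

lemma card_conjugators_into_bruhat_cell:
  fixes g :: "'a::{field, finite} mat"
  assumes "g \<in> carrier (GL n)" "w permutes {..<n}"
  shows "card (conjugators_into n g (bruhat_cell n w)) =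
    card (borel_subgroup n :: 'a mat set) * card (lusztig_variety n w g)"
  unfolding lusztig_variety_def
  by (rule card_conjugators_into[OF assms(1) subgroup_borel bruhat_cell_conjugate[OF assms(2)]])

theorem proposition2p3:
  fixes g :: "'a::{field, finite} mat" and n :: nat and \<pi> :: "nat list"
  assumes "g \<in> carrier (GL n)"
    and "\<forall>m\<in>set \<pi>. 0 < m"
    and "sum_list \<pi> = n"
  shows "(of_nat (card (parabolic_springer_fiber n \<pi> g)) :: rat) =
    1 / young_poincare n \<pi> (of_nat CARD('a)) *
      (\<Sum>w\<in>young_subgroup n \<pi>. of_nat (card (lusztig_variety n w g)))"
proof -
  let ?B = "borel_subgroup n :: 'a mat set"
  let ?P = "parabolic_subgroup n \<pi> :: 'a mat set"
  let ?W = "young_subgroup n \<pi>"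
  let ?q = "\<Sum>w\<in>?W. CARD('a) ^ perm_length n w"
  have W: "w permutes {..<n}" if "w \<in> ?W" for w using that by (simp add: young_subgroup_def)
  have cardP: "card ?P = card ?B * ?q"
    using card_parabolic_subgroup[of \<pi>, where 'a = 'a] assms(3) by simp
  have "conjugators_into n g ?P = (\<Union>w\<in>?W. conjugators_into n g (bruhat_cell n w))"
    using parabolic_subgroup_eq_Union_bruhat_cells[of \<pi>, where 'a = 'a] assms(3)
    by (auto simp: conjugators_into_def)
  \<comment> \<open>the union is disjoint because the Bruhat cells are\<close>
  moreover have "card (\<Union>w\<in>?W. conjugators_into n g (bruhat_cell n w)) =
      (\<Sum>w\<in>?W. card (conjugators_into n g (bruhat_cell n w)))"
  proof (rule card_UN_disjoint)
    show "finite ?W" by (rule finite_young_subgroup)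
    show "\<forall>w\<in>?W. finite (conjugators_into n g (bruhat_cell n w))"
      using finite_subset[OF _ finite_GL[of n, where 'a = 'a]] by (auto simp: conjugators_into_def)
    show "\<forall>w\<in>?W. \<forall>v\<in>?W. w \<noteq> v \<longrightarrow>
        conjugators_into n g (bruhat_cell n w) \<inter> conjugators_into n g (bruhat_cell n v) = {}"
      using bruhat_cell_inj[OF W W, where 'a = 'a] unfolding conjugators_into_def by blast
  qed
  ultimately have "card ?P * card (parabolic_springer_fiber n \<pi> g) =
      (\<Sum>w\<in>?W. card ?B * card (lusztig_variety n w g))"
    using card_conjugators_into_parabolic[of g \<pi>] card_conjugators_into_bruhat_cell[OF assms(1) W]
      assms(1,3) by simp
  then have "card ?B * (?q * card (parabolic_springer_fiber n \<pi> g)) =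
      card ?B * (\<Sum>w\<in>?W. card (lusztig_variety n w g))"
    by (simp only: cardP sum_distrib_left[symmetric] mult.assoc)
  moreover have "card ?P > 0"
    using finite_subset[OF _ finite_GL[of n], of ?P] subgroup.one_closed[OF subgroup_parabolic[of \<pi>]]
      assms(3) by (auto simp: card_gt_0_iff parabolic_subgroup_def)
  then have pos: "card ?B > 0" "?q > 0" using cardP by simp_all
  ultimately have "?q * card (parabolic_springer_fiber n \<pi> g) =
      (\<Sum>w\<in>?W. card (lusztig_variety n w g))"
    by simp
  then have "(of_nat ?q :: rat) * of_nat (card (parabolic_springer_fiber n \<pi> g)) =
      (\<Sum>w\<in>?W. of_nat (card (lusztig_variety n w g)))"
    by (simp only: of_nat_mult[symmetric] of_nat_sum[symmetric])
  moreover have "young_poincare n \<pi> (of_nat CARD('a)) = of_nat ?q"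
    by (simp add: young_poincare_def)
  moreover have "(of_nat ?q :: rat) \<noteq> 0" using pos(2) by (simp only: of_nat_eq_0_iff)
  ultimately show ?thesis by (simp add: field_simps)
qed

end
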